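(* Let $G$ be a loopless cubic multigraph with a fixed nowhere-zero three-bit flow $f\colon E(G)\to\mathbb F_2^3$ and, at every vertex $v$, a fixed ordering $a_v,b_v,c_v$ of the three edges incident with $v$. Let $g_{v,e}$ be the local offsets and $d_e$ the offset discrepancies determined by $f$ and these orderings. Then there exist vectors $t_v\in\mathbb F_2^3$, one for each vertex $v\in V(G)$, and bits $\epsilon_e\in\{0,1\}$, one for each edge $e\in E(G)$, such that $$t_u\oplus t_v\oplus\epsilon_e f(e)=d_e\qquad\text{for every edge } e=uv .$$ Equivalently, there exist vectors $t_v\in\mathbb F_2^3$ ($v\in V(G)$) such that $Q_{u,e}(t_u)=Q_{v,e}(t_v)$ for every edge $e=uv$.
   Context: Graphs are finite undirected multigraphs; parallel edges are distinct edge objects. Cubic means every vertex has degree three. $\delta(v)$ is the set of edges incident with $v$. $\oplus$ denotes addition in $\mathbb F_2^3=\{0,1\}^3$ and $000$ its zero vector; for a bit $\epsilon$ and vector $s$, $\epsilon s$ is scalar multiplication. A three-bit flow is a map $f\colon E(G)\to\mathbb F_2^3$ such that, for an orientation of the edges, at every vertex the sum of $f$ over outgoing edges equals the sum over incoming edges; for loopless $G$ this is equivalent, independently of the orientation, to $\bigoplus_{e\in\delta(v)}f(e)=000$ at every vertex $v$. It is nowhere-zero if $f(e)\ne 000$ for all $e$. Local offsets, for $e\in\delta(v)$: $g_{v,e}=f(a_v)$ if $e=b_v$, and $g_{v,e}=000$ if $e=a_v$ or $e=c_v$. Offset discrepancy of an edge $e=uv$: $d_e=g_{u,e}\oplus g_{v,e}$.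 For $t\in\mathbb F_2^3$ and $e\in\delta(v)$, the side set assigned to $e$ at $v$ by the triangle translated by $t$ is $Q_{v,e}(t)=\{t\oplus g_{v,e},\ t\oplus g_{v,e}\oplus f(e)\}$. *)

theory Defs
  imports "HOL-Analysis.Analysis" "HOL-Library.Z2" "HOL-Library.Uprod"
begin

text \<open>\<open>Upair v v\<close> is admitted as the end pair of an edge, so loops are possible
  until \<open>loopless\<close> excludes them.\<close>

record ('v, 'e) multigraph =
  verts :: "'v set"
  edges :: "'e set"
  ends :: "'e \<Rightarrow> 'v uprod"

locale finite_multigraph =
  fixes G :: "('v, 'e) multigraph"
  assumes finite_verts: "finite (verts G)"
    and finite_edges: "finite (edges G)"
    and ends_in_verts: "e \<in> edges G \<Longrightarrow> set_uprod (ends G e) \<subseteq> verts G"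

definition loopless :: "('v, 'e) multigraph \<Rightarrow> bool" where
  "loopless G \<longleftrightarrow> (\<forall>e\<in>edges G. proper_uprod (ends G e))"

definition incident_edges :: "('v, 'e) multigraph \<Rightarrow> 'v \<Rightarrow> 'e set" where
  "incident_edges G v = {e \<in> edges G. v \<in> set_uprod (ends G e)}"

text \<open>A loop counts twice towards the degree.\<close>

definition degree :: "('v, 'e) multigraph \<Rightarrow> 'v \<Rightarrow> nat" where
  "degree G v = card (incident_edges G v) + card {e \<in> edges G. ends G e = Upair v v}"

definition cubic :: "('v, 'e) multigraph \<Rightarrow> bool" where
  "cubic G \<longleftrightarrow> (\<forall>v\<in>verts G. degree G v = 3)"

definition orientation :: "('v, 'e) multigraph \<Rightarrow> ('e \<Rightarrow> 'v) \<Rightarrow> ('e \<Rightarrow> 'v) \<Rightarrow> bool" where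
  "orientation G tail head \<longleftrightarrow> (\<forall>e\<in>edges G. ends G e = Upair (tail e) (head e))"

text \<open>\<open>bit\<close> is the field with two elements, so \<open>+\<close> on \<open>bit ^ 3\<close> is bitwise
  exclusive or and \<open>*s\<close> is multiplication of a vector by a bit.\<close>

definition three_bit_flow :: "('v, 'e) multigraph \<Rightarrow> ('e \<Rightarrow> bit ^ 3) \<Rightarrow> bool" where
  "three_bit_flow G f \<longleftrightarrow>
     (\<exists>tail head. orientation G tail head \<and>
        (\<forall>v\<in>verts G. (\<Sum>e | e \<in> edges G \<and> tail e = v. f e) = (\<Sum>e | e \<in> edges G \<and> head e = v. f e)))"

definition nowhere_zero :: "('v, 'e) multigraph \<Rightarrow> ('e \<Rightarrow> bit ^ 3) \<Rightarrow> bool" where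
  "nowhere_zero G f \<longleftrightarrow> (\<forall>e\<in>edges G. f e \<noteq> 0)"

definition incidence_ordering ::
    "('v, 'e) multigraph \<Rightarrow> ('v \<Rightarrow> 'e) \<Rightarrow> ('v \<Rightarrow> 'e) \<Rightarrow> ('v \<Rightarrow> 'e) \<Rightarrow> bool" where
  "incidence_ordering G a b c \<longleftrightarrow>
     (\<forall>v\<in>verts G. distinct [a v, b v, c v] \<and> {a v, b v, c v} = incident_edges G v)"

text \<open>Used only for \<open>e\<close> incident with \<open>v\<close>; the third edge of the ordering, like the
  first, gets offset zero.\<close>

definition local_offset ::
    "('e \<Rightarrow> bit ^ 3) \<Rightarrow> ('v \<Rightarrow> 'e) \<Rightarrow> ('v \<Rightarrow> 'e) \<Rightarrow> 'v \<Rightarrow> 'e \<Rightarrow> bit ^ 3" where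
  "local_offset f a b v e = (if e = b v then f (a v) else 0)"

text \<open>The sum runs over the set of ends, hence has two terms only for a non-loop.\<close>

definition offset_discrepancy ::
    "('v, 'e) multigraph \<Rightarrow> ('e \<Rightarrow> bit ^ 3) \<Rightarrow> ('v \<Rightarrow> 'e) \<Rightarrow> ('v \<Rightarrow> 'e) \<Rightarrow> 'e \<Rightarrow> bit ^ 3" where
  "offset_discrepancy G f a b e = (\<Sum>v\<in>set_uprod (ends G e). local_offset f a b v e)"

lemma offset_discrepancy_eq:
  assumes "loopless G" "e \<in> edges G" "ends G e = Upair u v"
  shows "offset_discrepancy G f a b e = local_offset f a b u e + local_offset f a b v e"
proof -
  from assms have "u \<noteq> v"
    unfolding loopless_def by fastforce
  with assms(3) show ?thesis
    by (simp add: offset_discrepancy_def)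
qed

definition side_set ::
    "('e \<Rightarrow> bit ^ 3) \<Rightarrow> ('v \<Rightarrow> 'e) \<Rightarrow> ('v \<Rightarrow> 'e) \<Rightarrow> 'v \<Rightarrow> 'e \<Rightarrow> bit ^ 3 \<Rightarrow> (bit ^ 3) set" where
  "side_set f a b v e t =
     {t + local_offset f a b v e, t + local_offset f a b v e + f e}"

end

theory Submission
  imports Defs "HOL-Library.Function_Algebras"
begin

text \<open>
  The equations for \<open>t\<close> and \<open>\<epsilon>\<close> form a linear system over the field with two elements, so it
  suffices to show that every linear combination of the left-hand sides that vanishes
  identically also kills the right-hand sides (\<open>bit_fredholm_alternative\<close>). Such a combination
  is a map \<open>y\<close> from edges to \<open>bit ^ 3\<close>; vanishing in the unknown \<open>\<epsilon> e\<close> means that \<open>y e\<close> is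
  orthogonal to \<open>f e\<close>, and vanishing in the unknown \<open>t v\<close> means that \<open>y\<close> sums to zero around
  \<open>v\<close>, that is, \<open>y\<close> is itself a flow (\<open>edge_system_solvable\<close>).

  Paired with \<open>y\<close>, the discrepancies contribute, vertex by vertex, the bits
  \<open>y (b v) \<bullet> f (a v)\<close>, where the dot is the standard pairing on \<open>bit ^ 3\<close>. The heart of the proof
  is that this bit is the parity of the number of edges at \<open>v\<close> on which \<open>y\<close> is nonzero
  (\<open>cross_pairing_eq_support_parity\<close>). The only nontrivial case is that \<open>y\<close> vanishes on none of
  the three edges: then \<open>f\<close> and \<open>y\<close> both span planes at \<open>v\<close>, and two planes in a
  three-dimensional space cannot be orthogonal to each other, so the bit is one. Summed over all
  vertices, every edge in the support of \<open>y\<close> is counted at both of its ends, and the total is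
  zero.
\<close>

section \<open>Pairing of vectors over the two-element field\<close>

lemma bit_add_self: "x + x = (0 :: bit)"
  by (cases x; simp)

lemma bit_add_eq_0_iff: "x + y = 0 \<longleftrightarrow> x = (y :: bit)"
  by (cases x; cases y; simp)

lemma bit_vec_add_self [simp]: "x + x = (0 :: bit ^ 'n)"
  by (simp add: vec_eq_iff)

lemma bit_vec_add_eq_0_iff: "x + y = 0 \<longleftrightarrow> x = (y :: bit ^ 'n)"
  by (metis add.assoc add.right_neutral add_0 bit_vec_add_self)

definition bit_dot :: "bit ^ 'n \<Rightarrow> bit ^ 'n \<Rightarrow> bit" where
  "bit_dot x y = (\<Sum>i\<in>UNIV. x $ i * y $ i)"

lemma bit_dot_add_left: "bit_dot (x + x') y = bit_dot x y + bit_dot x' y"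
  by (simp only: bit_dot_def vector_add_component distrib_right sum.distrib)

lemma bit_dot_add_right: "bit_dot x (y + y') = bit_dot x y + bit_dot x y'"
  by (simp only: bit_dot_def vector_add_component distrib_left sum.distrib)

lemma bit_dot_zero_left [simp]: "bit_dot 0 y = 0"
  and bit_dot_zero_right [simp]: "bit_dot x 0 = 0"
  by (simp_all add: bit_dot_def)

lemma bit_dot_sum_left: "bit_dot (sum x A) y = (\<Sum>k\<in>A. bit_dot (x k) y)"
  by (induction A rule: infinite_finite_induct) (simp_all add: bit_dot_add_left)

lemma bit_dot_sum_right: "bit_dot x (sum y A) = (\<Sum>k\<in>A. bit_dot x (y k))"
  by (induction A rule: infinite_finite_induct) (simp_all add: bit_dot_add_right)

lemma bit_dot_axis_right: "bit_dot x (axis i 1) = x $ i"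
proof -
  have "bit_dot x (axis i 1) = (\<Sum>j\<in>UNIV. if j = i then x $ j else 0)"
    unfolding bit_dot_def by (rule sum.cong) (auto simp: axis_def)
  then show ?thesis
    by simp
qed

text \<open>The vectors orthogonal to two independent vectors of a three-dimensional space form a line,
  which over the two-element field has a single nonzero point: the cross product.
  Index arithmetic in the type \<open>3\<close> is cyclic.\<close>

lemma orthogonal_to_independent_pair:
  fixes x y z :: "bit ^ 3"
  assumes "x \<noteq> 0" "y \<noteq> 0" "x \<noteq> y" "z \<noteq> 0"
    and "bit_dot x z = 0" "bit_dot y z = 0"
  shows "z = (\<chi> i. x $ (i + 1) * y $ (i + 2) + x $ (i + 2) * y $ (i + 1))"
proof -
  have *: "(3::3) + 1 = 1" "(3::3) + 2 = 2" "(2::3) + 1 = 3" "(2::3) + 2 = 1" "(1::3) + 1 = 2"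
    "(1::3) + 2 = 3"
    by simp_all
  show ?thesis
    using assms
    unfolding vec_eq_iff bit_dot_def forall_3 sum_3 vec_lambda_beta * zero_index
    by (cases "x $ 1"; cases "x $ 2"; cases "x $ 3"; cases "y $ 1"; cases "y $ 2"; cases "y $ 3";
        simp; cases "z $ 1"; cases "z $ 2"; cases "z $ 3"; simp)
qed

text \<open>This is the local identity at a vertex whose edges carry the flow values \<open>p\<close>, \<open>q\<close>, \<open>p + q\<close>
  and the dual values \<open>x\<close>, \<open>y\<close>, \<open>x + y\<close>. If one dual value is zero, the orthogonality assumptions
  give the bit zero, and an even number of dual values is nonzero. If none is zero, the bit zero
  would make the plane of \<open>p\<close> and \<open>q\<close> orthogonal to the plane of \<open>x\<close> and \<open>y\<close>.\<close>

lemma cross_pairing_eq_support_parity: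
  fixes p q x y :: "bit ^ 3"
  assumes "p \<noteq> 0" "q \<noteq> 0" "p + q \<noteq> 0"
    and px: "bit_dot x p = 0" and qy: "bit_dot y q = 0" and pq: "bit_dot (x + y) (p + q) = 0"
  shows "bit_dot y p = of_bool (x \<noteq> 0) + of_bool (y \<noteq> 0) + of_bool (x + y \<noteq> 0)"
proof -
  have "bit_dot y p + bit_dot x q = 0"
    using pq by (simp only: bit_dot_add_left bit_dot_add_right px qy) (simp add: add.commute)
  then have sym: "bit_dot y p = bit_dot x q"
    by (simp only: bit_add_eq_0_iff)
  show ?thesis
  proof (cases "x = 0 \<or> y = 0 \<or> x = y")
    case True
    then have "bit_dot y p = 0"
      using px qy sym by auto
    then show ?thesis
      using True by auto
  next
    case False
    have "bit_dot y p \<noteq> 0"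
    proof
      assume yp: "bit_dot y p = 0"
      then have xq: "bit_dot x q = 0"
        by (simp add: sym)
      have "p = q"
        using orthogonal_to_independent_pair [of x y p] orthogonal_to_independent_pair [of x y q]
          False assms xq yp by simp
      then show False
        using assms by simp
    qed
    then show ?thesis
      using False by (simp add: bit_vec_add_eq_0_iff)
  qed
qed

section \<open>Solvability of linear systems over the two-element field\<close>

lemma sum_insert_fun_upd:
  fixes c g :: "'i \<Rightarrow> 'a::semiring_0"
  assumes "finite I" "k \<notin> I"
  shows "(\<Sum>i\<in>insert k I. (c(k := d)) i * g i) = d * g k + (\<Sum>i\<in>I. c i * g i)"
proof -
  have "(\<Sum>i\<in>I. (c(k := d)) i * g i) = (\<Sum>i\<in>I. c i * g i)"
    using assms by (intro sum.cong) auto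
  then show ?thesis
    using assms by (simp del: fun_upd_apply add: fun_upd_same)
qed

text \<open>The proof adds functionals to the family one at a time. A new functional \<open>L k\<close> changes the
  common kernel only if some \<open>z\<close> in the old kernel has \<open>L k z = 1\<close>. Subtracting \<open>M z\<close> times \<open>L k\<close>
  from \<open>M\<close> then reduces to the old family: a vector of the old kernel that is not in the new one
  gets there by adding \<open>z\<close>, which does not change the value of the difference.\<close>

lemma bit_functional_in_span:
  fixes L :: "'i \<Rightarrow> 'a::ab_group_add \<Rightarrow> bit" and M :: "'a \<Rightarrow> bit"
  assumes "finite I"
    and L: "\<And>i x y. L i (x + y) = L i x + L i y"
    and "\<And>x y. M (x + y) = M x + M y"
    and "\<And>x. (\<forall>i\<in>I. L i x = 0) \<Longrightarrow> M x = 0"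
  shows "\<exists>c. \<forall>x. M x = (\<Sum>i\<in>I. c i * L i x)"
  using assms(1,3,4)
proof (induction I arbitrary: M rule: finite_induct)
  case empty
  then show ?case
    by simp
next
  case (insert k I)
  note M = insert.prems(1)
  show ?case
  proof (cases "\<exists>z. (\<forall>i\<in>I. L i z = 0) \<and> L k z \<noteq> 0")
    case False
    have "\<exists>c. \<forall>x. M x = (\<Sum>i\<in>I. c i * L i x)"
    proof (rule insert.IH [OF M])
      fix x assume "\<forall>i\<in>I. L i x = 0"
      with False have "\<forall>i\<in>insert k I. L i x = 0"
        by blast
      then show "M x = 0"
        by (rule insert.prems(2))
    qed
    then obtain c where c: "\<And>x. M x = (\<Sum>i\<in>I. c i * L i x)"
      by blast
    have "M x = (\<Sum>i\<in>insert k I. (c(k := 0)) i * L i x)" for x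
      unfolding sum_insert_fun_upd [OF insert.hyps] using c by simp
    then show ?thesis
      by blast
  next
    case True
    then obtain z where z: "\<And>i. i \<in> I \<Longrightarrow> L i z = 0" "L k z = 1"
      by auto
    define N where "N x = M x + M z * L k x" for x
    have "\<exists>c. \<forall>x. N x = (\<Sum>i\<in>I. c i * L i x)"
    proof (rule insert.IH)
      show "N (x + y) = N x + N y" for x y
        by (simp only: N_def M L distrib_left ac_simps)
    next
      fix x assume x: "\<forall>i\<in>I. L i x = 0"
      show "N x = 0"
      proof (cases "L k x = 0")
        case True
        then show ?thesis
          using x insert.prems(2) [of x] by (simp add: N_def)
      next
        case False
        then have "M (x + z) = 0"
          using x z by (intro insert.prems(2)) (auto simp: L)
        then show ?thesis
          using False by (simp add: N_def M)
      qed
    qed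
    then obtain c where c: "\<And>x. N x = (\<Sum>i\<in>I. c i * L i x)"
      by blast
    have "M x = (\<Sum>i\<in>insert k I. (c(k := M z)) i * L i x)" for x
      unfolding sum_insert_fun_upd [OF insert.hyps] c [symmetric] N_def
      by (simp only: add.commute [of "M x"] add.assoc [symmetric] bit_add_self add_0_left)
    then show ?thesis
      by blast
  qed
qed

text \<open>A solution for the equations before \<open>k\<close> is corrected by a vector of their common kernel on
  which \<open>L k\<close> is one. If there is none, \<open>L k\<close> is a combination of the earlier functionals, and the
  compatibility assumption forces the earlier solution to satisfy equation \<open>k\<close> as well.\<close>

lemma bit_fredholm_alternative:
  fixes L :: "'i \<Rightarrow> 'a::ab_group_add \<Rightarrow> bit" and r :: "'i \<Rightarrow> bit"
  assumes "finite I"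
    and L: "\<And>i x y. L i (x + y) = L i x + L i y"
    and "\<And>c. (\<And>x. (\<Sum>i\<in>I. c i * L i x) = 0) \<Longrightarrow> (\<Sum>i\<in>I. c i * r i) = 0"
  shows "\<exists>x. \<forall>i\<in>I. L i x = r i"
  using assms(1,3)
proof (induction I rule: finite_induct)
  case empty
  then show ?case
    by simp
next
  case (insert k I)
  note split = sum_insert_fun_upd [OF insert.hyps]
  have "\<exists>x. \<forall>i\<in>I. L i x = r i"
  proof (rule insert.IH)
    fix c assume "\<And>x. (\<Sum>i\<in>I. c i * L i x) = 0"
    then show "(\<Sum>i\<in>I. c i * r i) = 0"
      using insert.prems [of "c(k := 0)"] by (simp only: split) simp
  qed
  then obtain x where x: "\<And>i. i \<in> I \<Longrightarrow> L i x = r i"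
    by blast
  show ?case
  proof (cases "\<exists>z. (\<forall>i\<in>I. L i z = 0) \<and> L k z \<noteq> 0")
    case True
    then obtain z where z: "\<And>i. i \<in> I \<Longrightarrow> L i z = 0" "L k z = 1"
      by auto
    show ?thesis
    proof (cases "L k x = r k")
      case True
      then show ?thesis
        using x by auto
    next
      case False
      then have "L k (x + z) = r k"
        using z by (cases "r k"; simp add: L)
      moreover have "L i (x + z) = r i" if "i \<in> I" for i
        using x z that by (simp add: L)
      ultimately show ?thesis
        by auto
    qed
  next
    case False
    then obtain c where c: "\<And>y. L k y = (\<Sum>i\<in>I. c i * L i y)"
      using bit_functional_in_span [OF insert.hyps(1), of L "L k"] L by blast
    have "(\<Sum>i\<in>insert k I. (c(k := 1)) i * r i) = 0"
      by (rule insert.prems) (simp only: split c [symmetric] mult_1 bit_add_self)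
    then have "r k = (\<Sum>i\<in>I. c i * r i)"
      by (simp only: split mult_1 bit_add_eq_0_iff)
    also have "\<dots> = L k x"
      using x by (simp add: c)
    finally show ?thesis
      using x by auto
  qed
qed

section \<open>Edge systems on a multigraph\<close>

lemma sum_verts_incident_edges:
  assumes "finite_multigraph G"
  shows "(\<Sum>v\<in>verts G. \<Sum>e\<in>incident_edges G v. h v e) =
         (\<Sum>e\<in>edges G. \<Sum>v\<in>set_uprod (ends G e). h v e)"
proof -
  interpret finite_multigraph G by fact
  have "{v \<in> verts G. v \<in> set_uprod (ends G e)} = set_uprod (ends G e)" if "e \<in> edges G" for e
    using ends_in_verts [OF that] by auto
  then show ?thesis
    using sum.swap_restrict [OF finite_verts finite_edges, of h
        "\<lambda>v e. v \<in> set_uprod (ends G e)"]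
    by (simp add: incident_edges_def)
qed

text \<open>A vanishing combination of the coordinate equations is read as a map \<open>y\<close> from edges to
  vectors; testing it on one unknown at a time yields the two conditions on \<open>y\<close>.\<close>

lemma edge_system_solvable:
  fixes G :: "('v, 'e) multigraph" and f d :: "'e \<Rightarrow> bit ^ 'n"
  assumes G: "finite_multigraph G"
    and dual: "\<And>y. (\<And>v. v \<in> verts G \<Longrightarrow> (\<Sum>e\<in>incident_edges G v. y e) = 0) \<Longrightarrow>
      (\<And>e. e \<in> edges G \<Longrightarrow> bit_dot (y e) (f e) = 0) \<Longrightarrow>
      (\<Sum>e\<in>edges G. bit_dot (y e) (d e)) = 0"
  shows "\<exists>t \<epsilon>. \<forall>e\<in>edges G. (\<Sum>v\<in>set_uprod (ends G e). t v) + \<epsilon> e *s f e = d e"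
proof -
  interpret finite_multigraph G by fact
  define S :: "'e \<Rightarrow> ('v \<Rightarrow> bit ^ 'n) \<times> ('e \<Rightarrow> bit) \<Rightarrow> bit ^ 'n"
    where "S e x = (\<Sum>v\<in>set_uprod (ends G e). fst x v) + snd x e *s f e" for e x
  have S_add: "S e (x + x') = S e x + S e x'" for e x x'
    by (simp only: S_def fst_add snd_add plus_fun_def sum.distrib vec.scale_left_distrib ac_simps)
  have "\<exists>x. \<forall>i\<in>edges G \<times> UNIV. (\<lambda>(e, j) x. S e x $ j) i x = (\<lambda>(e, j). d e $ j) i"
  proof (rule bit_fredholm_alternative)
    show "finite (edges G \<times> (UNIV :: 'n set))"
      using finite_edges by simp
    show "(\<lambda>(e, j) x. S e x $ j) i (x + x') =
        (\<lambda>(e, j) x. S e x $ j) i x + (\<lambda>(e, j) x. S e x $ j) i x'" for i x x'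
      by (simp add: S_add split: prod.splits)
  next
    fix c :: "'e \<times> 'n \<Rightarrow> bit"
    define y where "y e = (\<chi> j. c (e, j))" for e
    have pairing: "(\<Sum>i\<in>edges G \<times> UNIV. c i * (\<lambda>(e, j). g e $ j) i) =
        (\<Sum>e\<in>edges G. bit_dot (y e) (g e))" for g :: "'e \<Rightarrow> bit ^ 'n"
      by (simp only: bit_dot_def y_def vec_lambda_beta sum.cartesian_product case_prod_unfold
          prod.collapse)
    assume "(\<Sum>i\<in>edges G \<times> UNIV. c i * (\<lambda>(e, j) x. S e x $ j) i x) = 0" for x
    then have vanish: "(\<Sum>e\<in>edges G. bit_dot (y e) (S e x)) = 0" for x
      using pairing [of "\<lambda>e. S e x"] by (simp add: case_prod_unfold)
    have "(\<Sum>e\<in>edges G. bit_dot (y e) (d e)) = 0"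
    proof (rule dual)
      fix v assume v: "v \<in> verts G"
      have "(\<Sum>e\<in>incident_edges G v. y e) $ j = 0" for j
      proof -
        define t :: "'v \<Rightarrow> bit ^ 'n" where "t w = (if w = v then axis j 1 else 0)" for w
        have "0 = (\<Sum>e\<in>edges G. bit_dot (y e) (\<Sum>w\<in>set_uprod (ends G e). t w))"
          using vanish [of "(t, 0)"] by (simp add: S_def)
        also have "\<dots> = (\<Sum>w\<in>verts G. \<Sum>e\<in>incident_edges G w. bit_dot (y e) (t w))"
          by (simp add: bit_dot_sum_right sum_verts_incident_edges [OF G])
        also have "\<dots> = (\<Sum>w\<in>verts G.
            if w = v then bit_dot (\<Sum>e\<in>incident_edges G v. y e) (axis j 1) else 0)"
          by (intro sum.cong) (auto simp: t_def bit_dot_sum_left)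
        also have "\<dots> = bit_dot (\<Sum>e\<in>incident_edges G v. y e) (axis j 1)"
          using v finite_verts by simp
        finally show ?thesis
          by (simp only: bit_dot_axis_right)
      qed
      then show "(\<Sum>e\<in>incident_edges G v. y e) = 0"
        by (simp add: vec_eq_iff)
    next
      fix e assume e: "e \<in> edges G"
      define \<epsilon> :: "'e \<Rightarrow> bit" where "\<epsilon> e' = of_bool (e' = e)" for e'
      have "0 = (\<Sum>e'\<in>edges G. bit_dot (y e') (\<epsilon> e' *s f e'))"
        using vanish [of "(0, \<epsilon>)"] by (simp add: S_def)
      also have "\<dots> = (\<Sum>e'\<in>edges G. if e' = e then bit_dot (y e) (f e) else 0)"
        by (intro sum.cong) (auto simp: \<epsilon>_def)
      also have "\<dots> = bit_dot (y e) (f e)"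
        using e finite_edges by simp
      finally show "bit_dot (y e) (f e) = 0"
        by simp
    qed
    then show "(\<Sum>i\<in>edges G \<times> UNIV. c i * (\<lambda>(e, j). d e $ j) i) = 0"
      by (simp only: pairing)
  qed
  then obtain x where "\<And>e. e \<in> edges G \<Longrightarrow> S e x = d e"
    by (auto simp: vec_eq_iff)
  then show ?thesis
    unfolding S_def by blast
qed

section \<open>Flows and discrepancies\<close>

lemma sum_set_uprod_loopless:
  assumes "loopless G" "e \<in> edges G" "ends G e = Upair u v"
  shows "(\<Sum>w\<in>set_uprod (ends G e). h w) = h u + h v"
proof -
  have "u \<noteq> v"
    using assms unfolding loopless_def by fastforce
  then show ?thesis
    using assms(3) by simp
qed

text \<open>Without loops, the outgoing and the incoming edges partition the edges at \<open>v\<close>, and in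
  characteristic two equal sums over the two parts add up to zero.\<close>

lemma three_bit_flow_sum_incident:
  assumes "finite_multigraph G" "loopless G" "three_bit_flow G f" "v \<in> verts G"
  shows "(\<Sum>e\<in>incident_edges G v. f e) = 0"
proof -
  interpret finite_multigraph G by fact
  obtain tail head where o: "orientation G tail head"
    and flow: "(\<Sum>e | e \<in> edges G \<and> tail e = v. f e) = (\<Sum>e | e \<in> edges G \<and> head e = v. f e)"
    using assms(3,4) unfolding three_bit_flow_def by blast
  have ends: "ends G e = Upair (tail e) (head e)" "tail e \<noteq> head e" if "e \<in> edges G" for e
    using o that assms(2) unfolding orientation_def loopless_def by fastforce+
  have "incident_edges G v = {e. e \<in> edges G \<and> tail e = v} \<union> {e. e \<in> edges G \<and> head e = v}"
    using ends(1) by (auto simp: incident_edges_def)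
  moreover have "{e. e \<in> edges G \<and> tail e = v} \<inter> {e. e \<in> edges G \<and> head e = v} = {}"
    using not_sym [OF ends(2)] by auto
  ultimately have "(\<Sum>e\<in>incident_edges G v. f e) =
      (\<Sum>e | e \<in> edges G \<and> tail e = v. f e) + (\<Sum>e | e \<in> edges G \<and> head e = v. f e)"
    using finite_edges by (simp only:) (rule sum.union_disjoint; simp)
  then show ?thesis
    by (simp add: flow)
qed

text \<open>The double count \<open>sum_verts_incident_edges\<close> is used in both directions: first to distribute
  the discrepancies over the vertices, then to collect the local support parities, where each
  edge of the support of \<open>y\<close> is counted at two ends and cancels.\<close>

lemma dual_flow_annihilates_discrepancy:
  fixes f y :: "'e \<Rightarrow> bit ^ 3"
  assumes G: "finite_multigraph G" and loopless: "loopless G"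
    and flow: "three_bit_flow G f" and nz: "nowhere_zero G f"
    and ord: "incidence_ordering G a b c"
    and y_sum: "\<And>v. v \<in> verts G \<Longrightarrow> (\<Sum>e\<in>incident_edges G v. y e) = 0"
    and y_orth: "\<And>e. e \<in> edges G \<Longrightarrow> bit_dot (y e) (f e) = 0"
  shows "(\<Sum>e\<in>edges G. bit_dot (y e) (offset_discrepancy G f a b e)) = 0"
proof -
  have "(\<Sum>e\<in>edges G. bit_dot (y e) (offset_discrepancy G f a b e)) =
      (\<Sum>v\<in>verts G. \<Sum>e\<in>incident_edges G v. bit_dot (y e) (local_offset f a b v e))"
    by (simp add: offset_discrepancy_def bit_dot_sum_right sum_verts_incident_edges [OF G])
  also have "\<dots> = (\<Sum>v\<in>verts G. \<Sum>e\<in>incident_edges G v. of_bool (y e \<noteq> 0))"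
  proof (rule sum.cong [OF refl])
    fix v assume v: "v \<in> verts G"
    have dist: "a v \<noteq> b v" "a v \<noteq> c v" "b v \<noteq> c v" and inc: "incident_edges G v = {a v, b v, c v}"
      using ord v unfolding incidence_ordering_def by auto
    have sum_inc: "(\<Sum>e\<in>incident_edges G v. h e) = h (a v) + h (b v) + h (c v)" 
      for h :: "'e \<Rightarrow> bit"
      using dist by (simp only: inc sum.insert finite.intros insert_iff empty_iff sum.empty add_0_right
          add.assoc simp_thms)
    have edges: "a v \<in> edges G" "b v \<in> edges G" "c v \<in> edges G"
      using inc unfolding incident_edges_def by blast+
    have third: "g (c v) = g (a v) + g (b v)"
      if "(\<Sum>e\<in>incident_edges G v. g e) = 0" for g :: "'e \<Rightarrow> bit ^ 3"
    proof -
      have "(g (a v) + g (b v)) + g (c v) = 0"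
        using that dist by (simp add: inc add.assoc)
      then show ?thesis
        by (simp only: bit_vec_add_eq_0_iff)
    qed
    note fc = third [OF three_bit_flow_sum_incident [OF G loopless flow v]]
    note yc = third [OF y_sum [OF v]]
    have "(\<Sum>e\<in>incident_edges G v. bit_dot (y e) (local_offset f a b v e)) =
        bit_dot (y (b v)) (f (a v))"
      using dist by (simp add: inc local_offset_def)
    also have "\<dots> =
        of_bool (y (a v) \<noteq> 0) + of_bool (y (b v) \<noteq> 0) + of_bool (y (a v) + y (b v) \<noteq> 0)"
    proof (rule cross_pairing_eq_support_parity)
      show "f (a v) \<noteq> 0" "f (b v) \<noteq> 0" "f (a v) + f (b v) \<noteq> 0"
        using nz edges unfolding nowhere_zero_def fc [symmetric] by blast+
      show "bit_dot (y (a v)) (f (a v)) = 0" "bit_dot (y (b v)) (f (b v)) = 0"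
        using y_orth edges by blast+
      show "bit_dot (y (a v) + y (b v)) (f (a v) + f (b v)) = 0"
        using y_orth [OF edges(3)] by (simp only: fc yc)
    qed
    also have "\<dots> = (\<Sum>e\<in>incident_edges G v. of_bool (y e \<noteq> 0))"
      by (simp only: sum_inc yc)
    finally show "(\<Sum>e\<in>incident_edges G v. bit_dot (y e) (local_offset f a b v e)) =
        (\<Sum>e\<in>incident_edges G v. of_bool (y e \<noteq> 0))" .
  qed
  also have "\<dots> = (\<Sum>e\<in>edges G. \<Sum>v\<in>set_uprod (ends G e). of_bool (y e \<noteq> 0))"
    by (rule sum_verts_incident_edges [OF G])
  also have "\<dots> = 0"
  proof (rule sum.neutral, rule ballI)
    fix e assume e: "e \<in> edges G"
    obtain u v where "ends G e = Upair u v"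
      by (metis uprod_exhaust)
    then show "(\<Sum>v\<in>set_uprod (ends G e). of_bool (y e \<noteq> 0)) = (0 :: bit)"
      by (subst sum_set_uprod_loopless [OF loopless e]) (simp_all only: bit_add_self)
  qed
  finally show ?thesis .
qed

text \<open>Each side set is a coset of \<open>{0, f e}\<close>, and the assumption says that the two base points
  differ by an element of that subgroup.\<close>

lemma side_set_eqI:
  assumes "t u + t v + \<epsilon> *s f e = local_offset f a b u e + local_offset f a b v e"
  shows "side_set f a b u e (t u) = side_set f a b v e (t v)"
proof -
  define p where "p = t u + local_offset f a b u e"
  define q where "q = t v + local_offset f a b v e"
  have "(p + q) + \<epsilon> *s f e =
      (t u + t v + \<epsilon> *s f e) + (local_offset f a b u e + local_offset f a b v e)"
    by (simp add: p_def q_def ac_simps)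
  also have "\<dots> = 0"
    by (simp add: assms)
  finally have pq: "p + q = \<epsilon> *s f e"
    by (simp only: bit_vec_add_eq_0_iff)
  have "p = (p + q) + q"
    by (simp add: add.assoc)
  then have "p = q + \<epsilon> *s f e"
    by (simp add: pq add.commute)
  then have "{p, p + f e} = {q, q + f e}"
    by (cases \<epsilon>) (auto simp: add.assoc)
  then show ?thesis
    by (simp add: side_set_def p_def q_def)
qed

theorem theorem9p1:
  fixes G :: "('v, 'e) multigraph"
    and f :: "'e \<Rightarrow> bit ^ 3"
    and a b c :: "'v \<Rightarrow> 'e"
  assumes "finite_multigraph G"
    and "loopless G"
    and "cubic G"
    and "three_bit_flow G f"
    and "nowhere_zero G f"
    and "incidence_ordering G a b c"
  shows "(\<exists>(t :: 'v \<Rightarrow> bit ^ 3) (\<epsilon> :: 'e \<Rightarrow> bit).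
            \<forall>e\<in>edges G. \<forall>u v. ends G e = Upair u v \<longrightarrow>
              t u + t v + \<epsilon> e *s f e = offset_discrepancy G f a b e)
       \<and> (\<exists>t :: 'v \<Rightarrow> bit ^ 3.
            \<forall>e\<in>edges G. \<forall>u v. ends G e = Upair u v \<longrightarrow>
              side_set f a b u e (t u) = side_set f a b v e (t v))"
proof -
  obtain t :: "'v \<Rightarrow> bit ^ 3" and \<epsilon> :: "'e \<Rightarrow> bit" where
    "\<forall>e\<in>edges G. (\<Sum>v\<in>set_uprod (ends G e). t v) + \<epsilon> e *s f e = offset_discrepancy G f a b e"
    using edge_system_solvable [OF assms(1) dual_flow_annihilates_discrepancy
        [OF assms(1,2,4,5,6)]]
    by blast
  then have sol: "t u + t v + \<epsilon> e *s f e = offset_discrepancy G f a b e"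
    if "e \<in> edges G" "ends G e = Upair u v" for e u v
    using that sum_set_uprod_loopless [OF assms(2) that, of t] by metis
  have "side_set f a b u e (t u) = side_set f a b v e (t v)"
    if "e \<in> edges G" "ends G e = Upair u v" for e u v
    using sol [OF that] offset_discrepancy_eq [OF assms(2) that, of f a b]
    by (intro side_set_eqI) simp
  then show ?thesis
    using sol by blast
qed

end
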